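(* Let $n, m, N$ be positive integers and let $t$ be a non-negative integer such that $(t+1)(n-1)(m-1)+1\leq N\leq (t+2)(n-1)(m-1)$. Let $T_n$ be any tree on $n$ vertices, and let $G$ be a graph on $N$ vertices with minimum degree $\delta(G)\geq N-t(n-1)-1$. Then $G\rightarrow (T_n, K_m)$.
   Context: All graphs are finite and simple. For graphs $G, G_1, G_2$, the notation $G\rightarrow (G_1, G_2)$ means that every coloring of the edges of $G$ with two colors, red and blue, yields a red copy of $G_1$ or a blue copy of $G_2$ (copies are as not necessarily induced subgraphs). $K_m$ is the complete graph on $m$ vertices. *)

theory Defs
  imports Main
begin

record 'a ugraph =
  verts :: "'a set"
  edges :: "'a set set"

definition simple_graph :: "'a ugraph \<Rightarrow> bool" where
  "simple_graph G \<longleftrightarrow> finite (verts G) \<and> (\<forall>e\<in>edges G. e \<subseteq> verts G \<and> card e = 2)"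

definition adj :: "'a ugraph \<Rightarrow> 'a \<Rightarrow> 'a \<Rightarrow> bool" where
  "adj G u v \<longleftrightarrow> {u, v} \<in> edges G"

definition vertex_degree :: "'a ugraph \<Rightarrow> 'a \<Rightarrow> nat" where
  "vertex_degree G v = card {u \<in> verts G. adj G v u}"

(* Only meaningful when the vertex set is finite and nonempty. *)
definition min_degree :: "'a ugraph \<Rightarrow> nat" where
  "min_degree G = Min (vertex_degree G ` verts G)"

(* A walk is given by its list of vertices; a single vertex is a walk of length 0. *)
definition is_walk :: "'a ugraph \<Rightarrow> 'a list \<Rightarrow> bool" where
  "is_walk G p \<longleftrightarrow> p \<noteq> [] \<and> set p \<subseteq> verts G \<and> successively (adj G) p"

definition connected_graph :: "'a ugraph \<Rightarrow> bool" where
  "connected_graph G \<longleftrightarrow> verts G \<noteq> {} \<and>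
     (\<forall>u\<in>verts G. \<forall>v\<in>verts G. \<exists>p. is_walk G p \<and> hd p = u \<and> last p = v)"

(* The closing edge joins the last vertex to the first, which is not repeated in the list. *)
definition is_cycle :: "'a ugraph \<Rightarrow> 'a list \<Rightarrow> bool" where
  "is_cycle G p \<longleftrightarrow> is_walk G p \<and> distinct p \<and> 3 \<le> length p \<and> adj G (last p) (hd p)"

definition is_tree :: "'a ugraph \<Rightarrow> bool" where
  "is_tree G \<longleftrightarrow> simple_graph G \<and> connected_graph G \<and> (\<nexists>p. is_cycle G p)"

definition complete_graph :: "nat \<Rightarrow> nat ugraph" where
  "complete_graph m = \<lparr>verts = {..<m}, edges = {e. e \<subseteq> {..<m} \<and> card e = 2}\<rparr>"

(* The copy need not be induced: edges go to edges, non-edges are unconstrained. *)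
definition contains_copy :: "'a ugraph \<Rightarrow> 'b ugraph \<Rightarrow> bool" where
  "contains_copy G H \<longleftrightarrow>
     (\<exists>f. inj_on f (verts H) \<and> f ` verts H \<subseteq> verts G \<and> (\<forall>e\<in>edges H. f ` e \<in> edges G))"

datatype colour = Red | Blue

(* Colourings are total functions on vertex sets, but only their values on edges of G are used. *)
definition colour_subgraph :: "'a ugraph \<Rightarrow> ('a set \<Rightarrow> colour) \<Rightarrow> colour \<Rightarrow> 'a ugraph" where
  "colour_subgraph G c k = \<lparr>verts = verts G, edges = {e \<in> edges G. c e = k}\<rparr>"

definition arrows :: "'a ugraph \<Rightarrow> 'b ugraph \<Rightarrow> 'c ugraph \<Rightarrow> bool" where
  "arrows G G1 G2 \<longleftrightarrow>
     (\<forall>c. contains_copy (colour_subgraph G c Red) G1 \<or> contains_copy (colour_subgraph G c Blue) G2)"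

end

theory Submission
  imports Defs
begin

text \<open>
  Put \<open>k = n - 1\<close>: every vertex has at most \<open>t k\<close> non-neighbours other than itself, and this is
  inherited by vertex subsets. A graph of minimum degree at least \<open>k\<close> contains every tree on
  \<open>k + 1\<close> vertices, by greedy embedding. Hence, if there is no red tree, every nonempty vertex set
  \<open>A\<close> contains a vertex with fewer than \<open>k\<close> red neighbours in \<open>A\<close>, whose blue neighbourhood in \<open>A\<close>
  then has at least \<open>card A - (t + 1) k\<close> elements. Iterating inside blue neighbourhoods yields
  the blue clique.
\<close>

text \<open>Distinctness is demanded so that a path between two neighbours of a vertex outside
  \<open>W\<close> closes up to a cycle through that vertex. Carrying \<open>W\<close> as a
  parameter lets connectedness of an induced subgraph be expressed without constructing that
  subgraph.\<close>

definition path_in :: "'a ugraph \<Rightarrow> 'a set \<Rightarrow> 'a \<Rightarrow> 'a \<Rightarrow> 'a list \<Rightarrow> bool" where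
  "path_in G W u v p \<longleftrightarrow> p \<noteq> [] \<and> distinct p \<and> set p \<subseteq> W \<and> successively (adj G) p \<and> hd p = u \<and> last p = v"

definition path_connected :: "'a ugraph \<Rightarrow> 'a set \<Rightarrow> bool" where
  "path_connected G W \<longleftrightarrow> (\<forall>u\<in>W. \<forall>v\<in>W. \<exists>p. path_in G W u v p)"

lemma adj_sym: "adj G u v \<longleftrightarrow> adj G v u"
  by (simp add: adj_def insert_commute)

lemma simple_graph_adjD:
  assumes "simple_graph G" "adj G u v"
  shows "u \<noteq> v" "u \<in> verts G" "v \<in> verts G"
  using assms unfolding simple_graph_def adj_def by force+

lemma path_in_rev: "path_in G W u v p \<Longrightarrow> path_in G W v u (rev p)"
  unfolding path_in_def by (auto simp: hd_rev last_rev adj_sym[of G])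

lemma path_connected_insert:
  assumes "path_connected G W" "w \<in> W" "x \<notin> W" "adj G w x"
  shows "path_connected G (insert x W)"
proof -
  have to_x: "\<exists>p. path_in G (insert x W) u x p" if u: "u \<in> W" for u
  proof -
    obtain p where p: "path_in G W u w p"
      using assms(1,2) u unfolding path_connected_def by auto
    \<comment> \<open>Paths inside \<open>W\<close> avoid \<open>x\<close>, so appending
      \<open>x\<close> keeps the vertices distinct.\<close>
    have "x \<notin> set p"
      using p assms(3) unfolding path_in_def by auto
    then have "path_in G (insert x W) u x (p @ [x])"
      using p assms(4) unfolding path_in_def by (simp add: successively_append_iff subset_insertI2)
    then show ?thesis ..
  qed
  have within: "\<exists>p. path_in G (insert x W) u v p" if uv: "u \<in> W" "v \<in> W" for u v
  proof -
    obtain p where "path_in G W u v p"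
      using assms(1) uv unfolding path_connected_def by auto
    then have "path_in G (insert x W) u v p"
      unfolding path_in_def by auto
    then show ?thesis ..
  qed
  have from_x: "\<exists>p. path_in G (insert x W) x v p" if "v \<in> W" for v
    using to_x[OF that] path_in_rev by (elim exE) (rule exI)
  have "path_in G (insert x W) x x [x]"
    by (simp add: path_in_def)
  then show ?thesis
    unfolding path_connected_def using to_x from_x within by auto
qed

lemma successively_crossing:
  assumes "successively P p" "p \<noteq> []" "hd p \<in> W" "last p \<notin> W"
  shows "\<exists>w x. P w x \<and> w \<in> W \<and> x \<notin> W"
  using assms
proof (induction p rule: induct_list012)
  case (3 a b p)
  then show ?case by (cases "b \<in> W") auto
qed auto

text \<open>Two different neighbours of \<open>x\<close> in \<open>W\<close> would be joined by a
  path inside \<open>W\<close>, and \<open>x\<close> would close this path to a cycle. This is why a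
  new vertex in the greedy embedding has only one edge to respect.\<close>

lemma tree_unique_neighbour:
  assumes "is_tree T" "W \<subseteq> verts T" "path_connected T W"
    and "x \<notin> W" "w \<in> W" "y \<in> W" "adj T x w" "adj T x y"
  shows "y = w"
proof (rule ccontr)
  assume "y \<noteq> w"
  obtain p where p: "path_in T W w y p"
    using assms unfolding path_connected_def by blast
  \<comment> \<open>The ends of \<open>p\<close> differ; with \<open>x\<close> in front, the list
    reaches the length 3 required of a cycle.\<close>
  have "length p \<ge> 2"
    using p \<open>y \<noteq> w\<close> unfolding path_in_def by (cases p; cases "tl p") auto
  moreover have "x \<in> verts T"
    using assms simple_graph_adjD unfolding is_tree_def by metis
  moreover have "adj T y x"
    using assms(8) adj_sym by metis
  ultimately have "is_cycle T (x # p)"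
    using p assms(2,4,7) \<open>adj T y x\<close> unfolding is_cycle_def is_walk_def path_in_def
    by (auto simp: successively_Cons)
  then show False
    using assms unfolding is_tree_def by blast
qed

lemma tree_extension:
  assumes "is_tree T" "W \<subseteq> verts T" "W \<noteq> {}" "W \<noteq> verts T"
  obtains w x where "w \<in> W" "x \<in> verts T" "x \<notin> W" "adj T w x"
proof -
  obtain u v where "u \<in> W" "v \<in> verts T" "v \<notin> W"
    using assms by blast
  moreover from this obtain p where "is_walk T p" "hd p = u" "last p = v"
    using assms unfolding is_tree_def connected_graph_def by blast
  ultimately obtain w x where "adj T w x" "w \<in> W" "x \<notin> W"
    using successively_crossing[of "adj T" p W] unfolding is_walk_def by auto
  then show thesis
    using that simple_graph_adjD(3) assms(1) unfolding is_tree_def by metis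
qed

text \<open>A connected part \<open>W\<close> of the tree is embedded in \<open>S\<close> and
  enlarged by one vertex at a time. Degrees are counted inside \<open>S\<close>, so that the lemma
  applies to a vertex subset of the red graph directly.\<close>

lemma tree_embedding:
  assumes tree: "is_tree T" and H: "simple_graph H" and S: "S \<subseteq> verts H" "S \<noteq> {}"
    and deg: "\<And>v. v \<in> S \<Longrightarrow> card (verts T) - 1 \<le> card {u \<in> S. adj H v u}"
  shows "contains_copy H T"
proof -
  have fin: "finite (verts T)" and ne: "verts T \<noteq> {}"
    using tree unfolding is_tree_def simple_graph_def connected_graph_def by auto
  have T: "simple_graph T"
    using tree unfolding is_tree_def by blast
  have "\<exists>W f. W \<subseteq> verts T \<and> card W = Suc j \<and> path_connected T W \<and> inj_on f W \<and> f ` W \<subseteq> S \<and>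
      (\<forall>a\<in>W. \<forall>b\<in>W. adj T a b \<longrightarrow> adj H (f a) (f b))" if "Suc j \<le> card (verts T)" for j
    using that
  proof (induction j)
    case 0
    obtain r s where rs: "r \<in> verts T" "s \<in> S" using ne S by blast
    have "path_in T {r} r r [r]" by (simp add: path_in_def)
    then have "path_connected T {r}" by (auto simp: path_connected_def)
    moreover have "\<not> adj T r r" using simple_graph_adjD[OF T] by blast
    ultimately show ?case
      using rs by (intro exI[of _ "{r}"] exI[of _ "\<lambda>_. s"]) auto
  next
    case (Suc j)
    then obtain W f where W: "W \<subseteq> verts T" "card W = Suc j" "path_connected T W"
      and f: "inj_on f W" "f ` W \<subseteq> S" "\<forall>a\<in>W. \<forall>b\<in>W. adj T a b \<longrightarrow> adj H (f a) (f b)"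
      by auto
    have finW: "finite W" using W fin finite_subset by blast
    have "W \<noteq> {}" "W \<noteq> verts T" using W Suc.prems by auto
    then obtain w x where wx: "w \<in> W" "x \<in> verts T" "x \<notin> W" "adj T w x"
      using tree_extension[OF tree W(1)] by blast
    have "card (f ` W - {f w}) = j"
      using W(2) f(1) wx(1) finW by (simp add: card_image)
    moreover have "Suc j \<le> card {u \<in> S. adj H (f w) u}"
    proof -
      have "f w \<in> S" using f(2) wx(1) by blast
      then show ?thesis using deg[of "f w"] Suc.prems by simp
    qed
    ultimately have "\<not> {u \<in> S. adj H (f w) u} \<subseteq> f ` W - {f w}"
      using card_mono[of "f ` W - {f w}" "{u \<in> S. adj H (f w) u}"] finW by auto
    then obtain s where s: "s \<in> S" "adj H (f w) s" "s \<notin> f ` W"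
      using simple_graph_adjD(1)[OF H] by blast
    have unique: "y = w" if "y \<in> W" "adj T x y" for y
      using tree_unique_neighbour[OF tree W(1,3) wx(3,1) that(1)] that(2) wx(4) adj_sym by metis
    \<comment> \<open>The only new tree edge is the one between \<open>w\<close> and
      \<open>x\<close>, and \<open>s\<close> was chosen adjacent to \<open>f w\<close>.\<close>
    have edges: "adj H ((f(x := s)) a) ((f(x := s)) b)"
      if ab: "a \<in> insert x W" "b \<in> insert x W" "adj T a b" for a b
    proof -
      have "a \<noteq> b" using ab simple_graph_adjD(1)[OF T] by blast
      then consider "a \<in> W" "b \<in> W" | "a = x" "b \<in> W" | "a \<in> W" "b = x"
        using ab by blast
      then show ?thesis
      proof cases
        case 1
        then show ?thesis using f(3) ab(3) wx(3) by auto
      next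
        case 2
        then have "b = w" using unique ab(3) by blast
        then show ?thesis using 2 s(2) wx adj_sym by fastforce
      next
        case 3
        then have "a = w" using unique ab(3) adj_sym by metis
        then show ?thesis using 3 s(2) wx by auto
      qed
    qed
    have "inj_on (f(x := s)) (insert x W)"
      using f(1) s(3) wx(3) by (auto simp: inj_on_def)
    moreover have "(f(x := s)) ` insert x W \<subseteq> S"
      using f(2) s(1) wx(3) by auto
    moreover have "card (insert x W) = Suc (Suc j)"
      using W(2) wx(3) finW by simp
    moreover have "path_connected T (insert x W)"
      using path_connected_insert W(3) wx by metis
    moreover have "insert x W \<subseteq> verts T"
      using W(1) wx(2) by blast
    ultimately show ?case
      using edges by (intro exI[of _ "insert x W"] exI[of _ "f(x := s)"] conjI ballI impI)
  qed
  \<comment> \<open>A tree is nonempty, so this index gives a set \<open>W\<close> of full size,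
    which must be all of \<open>verts T\<close>.\<close>
  from this[of "card (verts T) - 1"] obtain W f where W: "W \<subseteq> verts T" "card W = card (verts T)"
    and f: "inj_on f W" "f ` W \<subseteq> S" "\<forall>a\<in>W. \<forall>b\<in>W. adj T a b \<longrightarrow> adj H (f a) (f b)"
    using fin ne by (auto simp: card_gt_0_iff Suc_le_eq)
  have "W = verts T" using W fin card_subset_eq by blast
  moreover have "\<forall>e\<in>edges T. f ` e \<in> edges H"
  proof
    fix e assume e: "e \<in> edges T"
    then obtain a b where ab: "e = {a, b}"
      using T unfolding simple_graph_def by (meson card_2_iff)
    then have "adj T a b" using e by (simp add: adj_def)
    then have "adj H (f a) (f b)"
      using f(3) \<open>W = verts T\<close> simple_graph_adjD[OF T] by blast
    then show "f ` e \<in> edges H" by (simp add: ab adj_def)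
  qed
  moreover have "f ` W \<subseteq> verts H"
    using f(2) S(1) by blast
  ultimately show ?thesis
    using f(1) unfolding contains_copy_def by auto
qed

lemma contains_copy_complete_graph:
  assumes "finite C" "C \<subseteq> verts G" "\<And>u v. u \<in> C \<Longrightarrow> v \<in> C \<Longrightarrow> u \<noteq> v \<Longrightarrow> adj G u v"
  shows "contains_copy G (complete_graph (card C))"
proof -
  obtain f where f: "bij_betw f {..<card C} C"
    using ex_bij_betw_nat_finite[OF assms(1)] by (auto simp: atLeast0LessThan)
  have "f ` e \<in> edges G" if e: "e \<subseteq> {..<card C}" "card e = 2" for e
  proof -
    obtain i j where ij: "e = {i, j}" "i \<noteq> j"
      using e(2) by (meson card_2_iff)
    then have "f i \<noteq> f j" "f i \<in> C" "f j \<in> C"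
      using f e(1) unfolding bij_betw_def inj_on_def by auto
    then have "adj G (f i) (f j)" using assms(3) by blast
    then show ?thesis by (simp add: ij adj_def)
  qed
  then show ?thesis
    using f assms(2) unfolding contains_copy_def complete_graph_def bij_betw_def
    by (intro exI[of _ f]) auto
qed

lemma simple_colour_subgraph: "simple_graph G \<Longrightarrow> simple_graph (colour_subgraph G c k)"
  by (auto simp: simple_graph_def colour_subgraph_def)

lemma adj_cases_colour:
  "adj G u v \<longleftrightarrow> adj (colour_subgraph G c Red) u v \<or> adj (colour_subgraph G c Blue) u v"
  using colour.exhaust[of "c {u, v}"] by (auto simp: adj_def colour_subgraph_def)

text \<open>The statement concerns arbitrary subsets \<open>A\<close> so that the induction can pass
  to a blue neighbourhood. Here \<open>m\<close> counts the rounds: each round costs at most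
  \<open>(t + 1) * k\<close> vertices, and the strict inequality leaves one vertex after the last
  round, whence the clique size \<open>Suc m\<close>.\<close>

lemma blue_clique:
  assumes tree: "is_tree T" and G: "simple_graph G"
    and red: "\<not> contains_copy (colour_subgraph G c Red) T"
    and k: "k = card (verts T) - 1"
    and "A \<subseteq> verts G" and "\<And>v. v \<in> A \<Longrightarrow> card {u \<in> A. u \<noteq> v \<and> \<not> adj G v u} \<le> t * k"
    and "(t + 1) * k * m < card A"
  shows "\<exists>C\<subseteq>A. card C = Suc m \<and>
    (\<forall>u\<in>C. \<forall>v\<in>C. u \<noteq> v \<longrightarrow> adj (colour_subgraph G c Blue) u v)"
  using assms(5-7)
proof (induction m arbitrary: A)
  case 0
  then obtain a where "a \<in> A" by fastforce
  then show ?case by (intro exI[of _ "{a}"]) auto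
next
  case (Suc m)
  let ?R = "adj (colour_subgraph G c Red)" and ?B = "adj (colour_subgraph G c Blue)"
  have fin: "finite A"
    using G Suc.prems(1) finite_subset unfolding simple_graph_def by blast
  have "A \<noteq> {}" using Suc.prems(3) by auto
  \<comment> \<open>Otherwise every vertex of \<open>A\<close> would have at least \<open>k\<close>
    red neighbours in \<open>A\<close>, and \<open>tree_embedding\<close> would give a red
    tree.\<close>
  then obtain v where v: "v \<in> A" "card {u \<in> A. ?R v u} < k"
    using tree_embedding[OF tree simple_colour_subgraph[OF G, of c Red], of A] red Suc.prems(1)
    unfolding k by (auto simp: colour_subgraph_def not_le[symmetric])
  let ?A = "{u \<in> A. ?B v u}"
  let ?U = "{u \<in> A. ?R v u} \<union> {u \<in> A. u \<noteq> v \<and> \<not> adj G v u} \<union> ?A"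
  have "A = insert v ?U"
    using v(1) adj_cases_colour[of G v _ c] by auto
  then have "card A = card (insert v ?U)"
    by (rule arg_cong)
  also have "\<dots> \<le> Suc (card ?U)"
    using fin by (simp add: card_insert_if)
  also have "\<dots> \<le> Suc (card {u \<in> A. ?R v u} + card {u \<in> A. u \<noteq> v \<and> \<not> adj G v u} + card ?A)"
    by (meson Suc_le_mono add_le_mono card_Un_le le_trans order_refl)
  \<comment> \<open>The strict bound on the red neighbours makes room for \<open>v\<close> itself:
    \<open>v\<close> and its red neighbours number at most \<open>k\<close>, and the non-neighbours
    at most \<open>t * k\<close>.\<close>
  also have "\<dots> \<le> (t + 1) * k + card ?A"
    using v Suc.prems(2)[OF v(1)] by simp
  finally have large: "(t + 1) * k * m < card ?A"
    using Suc.prems(3) by simp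
  \<comment> \<open>The bound counts non-neighbours rather than neighbours, so it survives shrinking
    the set.\<close>
  have "card {u \<in> ?A. u \<noteq> w \<and> \<not> adj G w u} \<le> t * k" if "w \<in> ?A" for w
  proof -
    have "card {u \<in> ?A. u \<noteq> w \<and> \<not> adj G w u} \<le> card {u \<in> A. u \<noteq> w \<and> \<not> adj G w u}"
      using fin by (intro card_mono) auto
    then show ?thesis using Suc.prems(2)[of w] that by simp
  qed
  then obtain C where C: "C \<subseteq> ?A" "card C = Suc m" "\<forall>u\<in>C. \<forall>v\<in>C. u \<noteq> v \<longrightarrow> ?B u v"
    using Suc.IH[of ?A] large Suc.prems(1) by blast
  have "v \<notin> C"
    using C(1) simple_graph_adjD(1)[OF simple_colour_subgraph[OF G]] by blast
  moreover have "finite C" using C(1) fin finite_subset by fastforce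
  ultimately have "card (insert v C) = Suc (Suc m)" using C(2) by simp
  \<comment> \<open>All of \<open>C\<close> lies in the blue neighbourhood of \<open>v\<close>, so
    \<open>v\<close> extends the clique.\<close>
  moreover have "?B a b" if "a \<in> insert v C" "b \<in> insert v C" "a \<noteq> b" for a b
  proof -
    have "?B v u" "?B u v" if "u \<in> C" for u
      using that C(1) adj_sym by fast+
    then show ?thesis
      using that C(3) by auto
  qed
  moreover have "insert v C \<subseteq> A"
    using C(1) v(1) by auto
  ultimately show ?case
    by blast
qed

theorem theorem1p3:
  fixes n m N t :: nat and T :: "'a ugraph" and G :: "'b ugraph"
  assumes "n \<ge> 1" and "m \<ge> 1" and "N \<ge> 1"
    and "(t + 1) * (n - 1) * (m - 1) + 1 \<le> N"
    and "N \<le> (t + 2) * (n - 1) * (m - 1)"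
    and "is_tree T" and "card (verts T) = n"
    and "simple_graph G" and "card (verts G) = N"
    and "int (min_degree G) \<ge> int N - int t * (int n - 1) - 1"
  shows "arrows G T (complete_graph m)"
  unfolding arrows_def
proof (intro allI impI disj_imp[THEN iffD2])
  fix c
  assume red: "\<not> contains_copy (colour_subgraph G c Red) T"
  have fin: "finite (verts G)"
    using assms(8) by (simp add: simple_graph_def)
  \<comment> \<open>The vertex \<open>v\<close>, its neighbours and its non-neighbours partition the
    \<open>N\<close> vertices, so the lower bound on the degree becomes an upper bound on the
    non-neighbours.\<close>
  have nonadj: "card {u \<in> verts G. u \<noteq> v \<and> \<not> adj G v u} \<le> t * (n - 1)" if v: "v \<in> verts G" for v
  proof -
    have "verts G = insert v ({u \<in> verts G. adj G v u} \<union> {u \<in> verts G. u \<noteq> v \<and> \<not> adj G v u})"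
      using v by auto
    moreover have "v \<notin> {u \<in> verts G. adj G v u} \<union> {u \<in> verts G. u \<noteq> v \<and> \<not> adj G v u}"
      using simple_graph_adjD(1)[OF assms(8)] by auto
    moreover have "card ({u \<in> verts G. adj G v u} \<union> {u \<in> verts G. u \<noteq> v \<and> \<not> adj G v u}) =
        vertex_degree G v + card {u \<in> verts G. u \<noteq> v \<and> \<not> adj G v u}"
      unfolding vertex_degree_def using fin by (intro card_Un_disjoint) auto
    ultimately have "N = Suc (vertex_degree G v + card {u \<in> verts G. u \<noteq> v \<and> \<not> adj G v u})"
      using assms(9) fin by (metis (no_types, lifting) card_insert_disjoint finite_insert)
    moreover have "min_degree G \<le> vertex_degree G v"
      unfolding min_degree_def using fin v by simp
    \<comment> \<open>Because \<open>n\<close> is positive, the integer difference in the degree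
      hypothesis agrees with the truncated one on naturals.\<close>
    moreover have "int t * (int n - 1) = int (t * (n - 1))"
      using assms(1) by (simp add: of_nat_diff)
    ultimately show ?thesis
      using assms(10) by linarith
  qed
  \<comment> \<open>A clique on \<open>m\<close> vertices takes \<open>m - 1\<close> rounds, and the
    lower bound on \<open>N\<close> is exactly the size required for these.\<close>
  obtain C where C: "C \<subseteq> verts G" "card C = Suc (m - 1)"
      "\<forall>u\<in>C. \<forall>v\<in>C. u \<noteq> v \<longrightarrow> adj (colour_subgraph G c Blue) u v"
    using blue_clique[OF assms(6,8) red, of "n - 1" "verts G" t "m - 1"] nonadj assms(4,7,9) by auto
  have "contains_copy (colour_subgraph G c Blue) (complete_graph (card C))"
    using C fin finite_subset
    by (intro contains_copy_complete_graph) (auto simp: colour_subgraph_def)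
  then show "contains_copy (colour_subgraph G c Blue) (complete_graph m)"
    using C(2) assms(2) by simp
qed

end
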